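(* Let $G$ be a finite group with identity $e$ and $H$ a non-trivial proper normal subgroup of $G$. Then for any odd integer $k$ between $1$ and $|H|$ (inclusive), $H$ is a $(0,k)$-regular set of $G$ if and only if for any $g\in G$ with $g^2\in H$ there exists an element $h\in H$ such that $(gh)^2=e$.
   Context: All groups are finite. For an inverse-closed subset $S$ of $G\setminus\{e\}$ (i.e. $S^{-1}=S$), $\mathrm{Cay}(G,S)$ is the graph with vertex set $G$ and edge set $\{\{x,y\}: x,y\in G,\ yx^{-1}\in S\}$. A $(0,k)$-regular set in a graph $\Gamma$ is a nonempty proper subset $D$ of $V(\Gamma)$ such that every vertex in $D$ has no neighbour in $D$ and every vertex in $V(\Gamma)\setminus D$ has exactly $k$ neighbours in $D$. A subset $D$ of a group $G$ is a $(0,k)$-regular set of $G$ if it is a $(0,k)$-regular set in $\mathrm{Cay}(G,S)$ for some inverse-closed $S\subseteq G\setminus\{e\}$. *)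

theory Defs
  imports "HOL-Algebra.Coset"
begin

text \<open>
  A simple undirected graph is a pair of a vertex set and a set of edges, the edges being
  two-element sets of vertices.
\<close>

type_synonym 'a ugraph = "'a set \<times> 'a set set"

definition vertices :: "'a ugraph \<Rightarrow> 'a set" where
  "vertices \<Gamma> = fst \<Gamma>"

definition edges :: "'a ugraph \<Rightarrow> 'a set set" where
  "edges \<Gamma> = snd \<Gamma>"

definition neighbours :: "'a ugraph \<Rightarrow> 'a \<Rightarrow> 'a set" where
  "neighbours \<Gamma> v = {u \<in> vertices \<Gamma>. {u, v} \<in> edges \<Gamma>}"

text \<open>
  Only meant for finite graphs: \<open>card\<close> is \<open>0\<close> on infinite sets.
\<close>

definition zero_regular_set :: "'a ugraph \<Rightarrow> nat \<Rightarrow> 'a set \<Rightarrow> bool" where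
  "zero_regular_set \<Gamma> k D \<longleftrightarrow>
     D \<noteq> {} \<and> D \<subset> vertices \<Gamma> \<and>
     (\<forall>v \<in> D. neighbours \<Gamma> v \<inter> D = {}) \<and>
     (\<forall>v \<in> vertices \<Gamma> - D. card (neighbours \<Gamma> v \<inter> D) = k)"

definition connection_set :: "('a, 'b) monoid_scheme \<Rightarrow> 'a set \<Rightarrow> bool" where
  "connection_set G S \<longleftrightarrow> S \<subseteq> carrier G - {\<one>\<^bsub>G\<^esub>} \<and> (\<lambda>s. inv\<^bsub>G\<^esub> s) ` S = S"

definition Cay :: "('a, 'b) monoid_scheme \<Rightarrow> 'a set \<Rightarrow> 'a ugraph" where
  "Cay G S = (carrier G,
     {{x, y} | x y. x \<in> carrier G \<and> y \<in> carrier G \<and> y \<otimes>\<^bsub>G\<^esub> inv\<^bsub>G\<^esub> x \<in> S})"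

definition group_zero_regular_set :: "('a, 'b) monoid_scheme \<Rightarrow> nat \<Rightarrow> 'a set \<Rightarrow> bool" where
  "group_zero_regular_set G k D \<longleftrightarrow>
     (\<exists>S. connection_set G S \<and> zero_regular_set (Cay G S) k D)"

lemma (in group) Cay_edge_iff:
  assumes S: "connection_set G S" and x: "x \<in> carrier G" and y: "y \<in> carrier G"
  shows "{x, y} \<in> edges (Cay G S) \<longleftrightarrow> y \<otimes> inv x \<in> S"
proof -
  have flip: "b \<otimes> inv a \<in> S"
    if "a \<otimes> inv b \<in> S" "a \<in> carrier G" "b \<in> carrier G" for a b
  proof -
    have "inv (a \<otimes> inv b) \<in> S"
      using that(1) S unfolding connection_set_def by blast
    then show ?thesis
      using that(2,3) by (simp add: inv_mult_group)
  qed
  show ?thesis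
    using flip x y by (auto simp: edges_def Cay_def doubleton_eq_iff)
qed

lemma (in group) Cay_simple:
  assumes S: "connection_set G S" and E: "E \<in> edges (Cay G S)"
  shows "E \<subseteq> vertices (Cay G S) \<and> card E = 2"
proof -
  obtain x y where xy: "E = {x, y}" "x \<in> carrier G" "y \<in> carrier G" "y \<otimes> inv x \<in> S"
    using E by (auto simp: edges_def Cay_def)
  then have "x \<noteq> y"
    using S by (auto simp: connection_set_def)
  then show ?thesis
    using xy by (simp add: vertices_def Cay_def)
qed

end

theory Submission
  imports Defs
begin

text \<open>
  The neighbours of \<open>v\<close> in \<open>H\<close> correspond, via \<open>u \<mapsto> v u\<^sup>-\<^sup>1\<close>, to the elements of the connection set \<open>S\<close>
  lying in the coset \<open>vH\<close>. So \<open>H\<close> is a \<open>(0,k)\<close>-regular set in \<open>Cay G S\<close> if and only if \<open>S\<close> avoids \<open>H\<close>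
  and meets every other coset in exactly \<open>k\<close> elements. On a coset \<open>gH\<close> with \<open>g\<^sup>2 \<in> H\<close> inversion acts as
  an involution: for odd \<open>k\<close> an invariant \<open>k\<close>-subset contains a fixed point, and conversely, given a
  fixed point, one can add to it points two at a time to reach every odd size. On the remaining
  cosets, which inversion pairs up, one takes any \<open>k\<close>-subset and its inverse.
\<close>

section \<open>Involutions on finite sets\<close>

text \<open>A two-element orbit \<open>{x, f x}\<close> can be removed without affecting parity or
  invariance, and the empty set is even, so some orbit is a single point.\<close>

lemma odd_card_involution_fixpoint:
  assumes "finite A" "odd (card A)"
    and "\<And>x. x \<in> A \<Longrightarrow> f x \<in> A" "\<And>x. x \<in> A \<Longrightarrow> f (f x) = x"
  shows "\<exists>x\<in>A. f x = x"
  using assms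
proof (induction A rule: finite_psubset_induct)
  case (psubset A)
  then obtain x where x: "x \<in> A"
    by (metis card.empty equals0I even_zero)
  show ?case
  proof (cases "f x = x")
    case False
    let ?B = "A - {x, f x}"
    have sub: "{x, f x} \<subseteq> A"
      using x psubset.prems by auto
    have "card A = card ?B + 2"
      using card_Diff_subset[OF _ sub] card_mono[OF psubset.hyps(1) sub] False by simp
    then have "odd (card ?B)"
      using psubset.prems(1) by simp
    moreover have "f y \<in> ?B" if "y \<in> ?B" for y
      using that x psubset.prems(2,3) by (metis DiffE DiffI insert_iff singletonD)
    ultimately have "\<exists>y\<in>?B. f y = y"
      using psubset.IH[of ?B] psubset.prems x by blast
    then show ?thesis
      by blast
  qed (use x in blast)
qed

text \<open>The fixed point \<open>t\<close> settles size one; from there an invariant pair can be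
  added as long as two points remain.\<close>

lemma ex_invariant_subset_odd_card:
  assumes "finite C"
    and closed: "\<And>x. x \<in> C \<Longrightarrow> f x \<in> C" and invol: "\<And>x. x \<in> C \<Longrightarrow> f (f x) = x"
    and "t \<in> C" "f t = t"
    and "odd k" "k \<le> card C"
  shows "\<exists>A\<subseteq>C. f ` A \<subseteq> A \<and> card A = k"
proof -
  have "\<exists>A\<subseteq>C. f ` A \<subseteq> A \<and> card A = 2 * n + 1" if "2 * n + 1 \<le> card C" for n
    using that
  proof (induction n)
    case 0
    show ?case
      using assms by (intro exI[of _ "{t}"]) auto
  next
    case (Suc n)
    then obtain A where A: "A \<subseteq> C" "f ` A \<subseteq> A" "card A = 2 * n + 1"
      by auto
    have finA: "finite A"
      using A(1) \<open>finite C\<close> finite_subset by blast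
    have cardD: "2 \<le> card (C - A)"
      using Suc.prems A finA by (simp add: card_Diff_subset)
    \<comment> \<open>As \<open>f\<close> is an involution and \<open>A\<close> is invariant, the
      complement of \<open>A\<close> in \<open>C\<close> is invariant too.\<close>
    have outside: "f x \<in> C - A" if "x \<in> C - A" for x
      using that closed[of x] invol[of x] A(2) by (metis DiffD1 DiffD2 DiffI image_subset_iff)
    \<comment> \<open>Either a two-element orbit is left, or all remaining points are fixed and any
      two of them will do.\<close>
    have "\<exists>B. B \<subseteq> C - A \<and> f ` B \<subseteq> B \<and> card B = 2"
    proof (cases "\<exists>x\<in>C - A. f x \<noteq> x")
      case True
      then obtain x where "x \<in> C - A" "f x \<noteq> x"
        by blast
      then show ?thesis
        using outside invol by (intro exI[of _ "{x, f x}"]) auto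
    next
      case False
      obtain B where "B \<subseteq> C - A" "card B = 2"
        using cardD by (meson obtain_subset_with_card_n)
      then show ?thesis
        using False by (intro exI[of _ B]) auto
    qed
    then obtain B where B: "B \<subseteq> C - A" "f ` B \<subseteq> B" "card B = 2"
      by blast
    have "card (A \<union> B) = 2 * Suc n + 1"
      using A B finA by (subst card_Un_disjoint) (auto intro: card_ge_0_finite)
    then show ?case
      using A B by (intro exI[of _ "A \<union> B"]) auto
  qed
  then show ?thesis
    using assms(6,7) by (metis oddE)
qed

section \<open>Inversion on the cosets of a normal subgroup\<close>

context normal
begin

lemma inv_mem_rcoset_inv:
  assumes "x \<in> carrier G" "y \<in> H #> x"
  shows "inv y \<in> H #> inv x"
  using rcos_inv[OF assms(1)] assms(2) by (auto simp: SET_INV_def)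

lemma rcoset_inv_eq:
  assumes "x \<in> carrier G" "y \<in> H #> x"
  shows "H #> inv y = H #> inv x"
  using repr_independence[OF inv_mem_rcoset_inv[OF assms]] assms(1) subgroup_axioms by simp

text \<open>Equality of the cosets reduces to membership of \<open>x\<close> in
  \<open>H #> inv x\<close>, that is, to \<open>x \<otimes> x \<in> H\<close>. This separates the
  cosets that inversion preserves from those it swaps with another coset.\<close>

lemma rcoset_inv_eq_self_iff:
  assumes "x \<in> carrier G"
  shows "H #> inv x = H #> x \<longleftrightarrow> x [^] (2::nat) \<in> H"
proof -
  have "H #> inv x = H #> x \<longleftrightarrow> x \<in> H #> inv x"
    using assms rcos_self[OF assms] repr_independence[of x H "inv x"] subgroup_axioms by auto
  also have "\<dots> \<longleftrightarrow> x \<otimes> x \<in> H"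
    using assms rcos_module[OF is_group, of "inv x" x] by simp
  finally show ?thesis
    using assms by (simp add: numeral_2_eq_2)
qed

lemma rcoset_subset_Diff:
  assumes "x \<in> carrier G - H"
  shows "H #> x \<subseteq> carrier G - H"
proof
  fix y assume y: "y \<in> H #> x"
  have "y \<in> carrier G"
    using y assms r_coset_subset_G[OF subset] by blast
  moreover have "y \<notin> H"
  proof
    assume "y \<in> H"
    then have "H #> x = H"
      using repr_independence[OF y] assms subgroup_axioms rcos_const by simp
    then show False
      using assms rcos_self[OF _ subgroup_axioms, of x] by auto
  qed
  ultimately show "y \<in> carrier G - H"
    by blast
qed

section \<open>Regularity as a count on cosets\<close>

lemma card_neighbours_Cay:
  assumes S: "connection_set G S" and v: "v \<in> carrier G"
  shows "card (neighbours (Cay G S) v \<inter> H) = card (S \<inter> (H #> v))"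
proof -
  have nb: "neighbours (Cay G S) v \<inter> H = {u \<in> H. v \<otimes> inv u \<in> S}"
    using Cay_edge_iff[OF S _ v] subset by (auto simp: neighbours_def vertices_def Cay_def)
  \<comment> \<open>The map lands in the left coset of \<open>v\<close>; normality turns it into the
    right coset afterwards.\<close>
  have "bij_betw (\<lambda>u. v \<otimes> inv u) {u \<in> H. v \<otimes> inv u \<in> S} (S \<inter> (v <# H))"
  proof (rule bij_betwI[where g = "\<lambda>s. inv s \<otimes> v"])
    show "(\<lambda>u. v \<otimes> inv u) \<in> {u \<in> H. v \<otimes> inv u \<in> S} \<rightarrow> S \<inter> (v <# H)"
      by (auto simp: l_coset_def)
    show "(\<lambda>s. inv s \<otimes> v) \<in> S \<inter> (v <# H) \<rightarrow> {u \<in> H. v \<otimes> inv u \<in> S}"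
      using v by (auto simp: l_coset_def inv_mult_group m_assoc)
    show "inv (v \<otimes> inv u) \<otimes> v = u" if "u \<in> {u \<in> H. v \<otimes> inv u \<in> S}" for u
      using that v by (auto simp: inv_mult_group m_assoc)
    show "v \<otimes> inv (inv s \<otimes> v) = s" if "s \<in> S \<inter> (v <# H)" for s
      using that v by (auto simp: l_coset_def inv_mult_group m_assoc)
  qed
  then show ?thesis
    using nb coset_eq v by (simp add: bij_betw_same_card)
qed

lemma zero_regular_set_Cay_iff:
  assumes fin: "finite (carrier G)" and S: "connection_set G S" and proper: "H \<noteq> carrier G"
  shows "zero_regular_set (Cay G S) k H \<longleftrightarrow>
    S \<inter> H = {} \<and> (\<forall>x\<in>carrier G - H. card (S \<inter> (H #> x)) = k)"
proof -
  have "neighbours (Cay G S) v \<inter> H = {} \<longleftrightarrow> S \<inter> H = {}" if "v \<in> H" for v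
  proof -
    \<comment> \<open>Finiteness lets \<open>card\<close> detect emptiness; the neighbour count then
      applies with \<open>H #> v = H\<close>.\<close>
    have "finite H"
      using fin finite_subset[OF subset] by blast
    then have "neighbours (Cay G S) v \<inter> H = {} \<longleftrightarrow> card (neighbours (Cay G S) v \<inter> H) = 0"
      by simp
    also have "\<dots> \<longleftrightarrow> card (S \<inter> H) = 0"
      using card_neighbours_Cay[OF S] that rcos_const by simp
    finally show ?thesis
      using \<open>finite H\<close> by simp
  qed
  then have "(\<forall>v\<in>H. neighbours (Cay G S) v \<inter> H = {}) \<longleftrightarrow> S \<inter> H = {}"
    using subgroup.one_closed[OF subgroup_axioms] by blast
  moreover have "(\<forall>v\<in>carrier G - H. card (neighbours (Cay G S) v \<inter> H) = k) \<longleftrightarrow>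
    (\<forall>x\<in>carrier G - H. card (S \<inter> (H #> x)) = k)"
    using card_neighbours_Cay[OF S] by simp
  moreover have "H \<noteq> {}" "H \<subset> carrier G"
    using subgroup.one_closed[OF subgroup_axioms] subset proper by blast+
  moreover have "vertices (Cay G S) = carrier G"
    by (simp add: vertices_def Cay_def)
  ultimately show ?thesis
    unfolding zero_regular_set_def by simp
qed

section \<open>Construction of a connection set\<close>

text \<open>The cosets of \<open>x\<close> and \<open>inv x\<close> are treated together because
  inversion carries one to the other. The conclusion is symmetric in the two, so that one piece can
  later be chosen for both.\<close>

lemma ex_inv_closed_meeting_rcosets:
  assumes fin: "finite (carrier G)" and k: "odd k" "k \<le> card H"
    and x: "x \<in> carrier G"
    and invol: "x [^] (2::nat) \<in> H \<Longrightarrow> \<exists>h\<in>H. (x \<otimes> h) [^] (2::nat) = \<one>"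
  shows "\<exists>A. (\<forall>a\<in>A. inv a \<in> A) \<and> card (A \<inter> (H #> x)) = k \<and> card (A \<inter> (H #> inv x)) = k"
proof -
  have sub: "H #> x \<subseteq> carrier G"
    using x r_coset_subset_G[OF subset] by blast
  have finC: "finite (H #> x)"
    using fin sub finite_subset by blast
  have card: "k \<le> card (H #> x)"
    using k card_rcosets_equal[OF _ subset, of "H #> x"] x rcosetsI[OF subset] by simp
  show ?thesis
  proof (cases "H #> inv x = H #> x")
    case True
    \<comment> \<open>The square of \<open>x\<close> lies in \<open>H\<close>, so the hypothesis
      applies; \<open>x \<otimes> h\<close> is its own inverse and serves as the fixed point of
      inversion on the coset.\<close>
    then obtain h where h: "h \<in> H" "(x \<otimes> h) [^] (2::nat) = \<one>"
      using invol rcoset_inv_eq_self_iff[OF x] by blast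
    have "x \<otimes> h \<in> H #> x"
      using h coset_eq x by (auto simp: l_coset_def)
    moreover have "inv (x \<otimes> h) = x \<otimes> h"
      using h x by (intro inv_equality) (auto simp: numeral_2_eq_2)
    moreover have "inv y \<in> H #> x" "inv (inv y) = y" if "y \<in> H #> x" for y
      using inv_mem_rcoset_inv[OF x that] True that sub by auto
    ultimately obtain A where A: "A \<subseteq> H #> x" "m_inv G ` A \<subseteq> A" "card A = k"
      using ex_invariant_subset_odd_card[OF finC _ _ _ _ k(1) card, of "m_inv G" "x \<otimes> h"] by blast
    have "A \<inter> (H #> x) = A"
      using A(1) by blast
    then show ?thesis
      using True A(2,3) by (intro exI[of _ A]) (simp add: image_subset_iff)
  next
    case False
    obtain T where T: "T \<subseteq> H #> x" "card T = k"
      using card by (meson obtain_subset_with_card_n)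
    have TG: "T \<subseteq> carrier G"
      using T sub by blast
    have invT: "m_inv G ` T \<subseteq> H #> inv x"
      using T inv_mem_rcoset_inv[OF x] by blast
    \<comment> \<open>Distinct cosets are disjoint, so adjoining the inverses of \<open>T\<close>
      does not change the count in \<open>H #> x\<close>.\<close>
    have disj: "(H #> x) \<inter> (H #> inv x) = {}"
      using False x pairwiseD[OF rcos_disjoint[OF subgroup_axioms]] rcosetsI[OF subset]
      unfolding disjnt_def by (metis inv_closed)
    have "card (m_inv G ` T) = k"
      using T TG by (metis card_image inj_on_subset inv_inj)
    moreover have "(T \<union> m_inv G ` T) \<inter> (H #> x) = T"
      "(T \<union> m_inv G ` T) \<inter> (H #> inv x) = m_inv G ` T"
      using T invT disj by blast+
    moreover have "\<forall>a\<in>T \<union> m_inv G ` T. inv a \<in> T \<union> m_inv G ` T"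
      using TG by auto
    ultimately show ?thesis
      using T by metis
  qed
qed

text \<open>Pieces chosen for the single cosets are glued. The choice must agree on a coset, to
  preserve counts, and on inverse cosets, to preserve closure under inversion.\<close>

lemma ex_connection_set_meeting_rcosets:
  assumes fin: "finite (carrier G)" and k: "odd k" "k \<le> card H"
    and invol: "\<And>g. g \<in> carrier G \<Longrightarrow> g [^] (2::nat) \<in> H \<Longrightarrow> \<exists>h\<in>H. (g \<otimes> h) [^] (2::nat) = \<one>"
  shows "\<exists>S. connection_set G S \<and> S \<inter> H = {} \<and> (\<forall>x\<in>carrier G - H. card (S \<inter> (H #> x)) = k)"
proof -
  define P where "P x A \<longleftrightarrow>
    (\<forall>a\<in>A. inv a \<in> A) \<and> card (A \<inter> (H #> x)) = k \<and> card (A \<inter> (H #> inv x)) = k" for x A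
  \<comment> \<open>\<open>P x\<close> depends only on the unordered pair of the cosets of \<open>x\<close> and \<open>inv x\<close>, hence so does \<open>U x\<close>.\<close>
  define U where "U x = (SOME A. P x A)" for x
  \<comment> \<open>Each element is tested against its own piece, since \<open>U x\<close> may also
    contain elements of unrelated cosets. Excluding \<open>H\<close> keeps out the identity as
    well.\<close>
  define S where "S = {x \<in> carrier G - H. x \<in> U x}"
  have U: "P x (U x)" if "x \<in> carrier G" for x
    unfolding U_def
    by (rule someI_ex) (use ex_inv_closed_meeting_rcosets[OF fin k that invol[OF that]] in
      \<open>simp add: P_def\<close>)
  have U_inv: "U (inv x) = U x" if "x \<in> carrier G" for x
  proof -
    have "P (inv x) = P x"
      using that by (auto simp: P_def fun_eq_iff)
    then show ?thesis
      by (simp add: U_def)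
  qed
  have U_rcoset: "U y = U x" if "x \<in> carrier G" "y \<in> H #> x" for x y
  proof -
    have "H #> y = H #> x"
      using repr_independence[OF that(2) that(1) subgroup_axioms] by simp
    then have "P y = P x"
      using rcoset_inv_eq[OF that] by (simp add: P_def fun_eq_iff)
    then show ?thesis
      by (simp add: U_def)
  qed
  have S_inv: "inv x \<in> S" if "x \<in> S" for x
  proof -
    have x: "x \<in> carrier G" "x \<notin> H" "x \<in> U x"
      using that by (auto simp: S_def)
    have "inv x \<notin> H"
      using x m_inv_closed[of "inv x"] by auto
    moreover have "inv x \<in> U x"
      using U[OF x(1)] x(3) by (simp add: P_def)
    ultimately show ?thesis
      using x U_inv by (simp add: S_def)
  qed
  have SG: "S \<subseteq> carrier G - {\<one>}"
    using one_closed by (auto simp: S_def)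
  have "x \<in> m_inv G ` S" if "x \<in> S" for x
    using S_inv[OF that] that SG by (intro image_eqI[of _ _ "inv x"]) auto
  then have "connection_set G S"
    using SG S_inv by (auto simp: connection_set_def)
  moreover have "card (S \<inter> (H #> x)) = k" if x: "x \<in> carrier G - H" for x
  proof -
    \<comment> \<open>All elements of the coset share the piece \<open>U x\<close>, and the coset
      misses \<open>H\<close>, so nothing is lost.\<close>
    have "S \<inter> (H #> x) = U x \<inter> (H #> x)"
      using U_rcoset x rcoset_subset_Diff[OF x] by (auto simp: S_def)
    then show ?thesis
      using U x by (simp add: P_def)
  qed
  moreover have "S \<inter> H = {}"
    by (auto simp: S_def)
  ultimately show ?thesis
    by blast
qed

section \<open>Self-inverse elements from odd counts\<close>

text \<open>Inversion preserves both \<open>S\<close> and the coset, so it has a fixed point on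
  their odd intersection. By normality this point has the form \<open>g \<otimes> h\<close>.\<close>

lemma ex_involution_in_rcoset:
  assumes fin: "finite (carrier G)" and S: "connection_set G S" and g: "g \<in> carrier G"
    and sq: "g [^] (2::nat) \<in> H" and odd: "odd (card (S \<inter> (H #> g)))"
  shows "\<exists>h\<in>H. (g \<otimes> h) [^] (2::nat) = \<one>"
proof -
  have sub: "H #> g \<subseteq> carrier G"
    using g r_coset_subset_G[OF subset] by blast
  have "finite (S \<inter> (H #> g))"
    using finite_subset[OF sub fin] by blast
  moreover have "inv s \<in> S \<inter> (H #> g)" if "s \<in> S \<inter> (H #> g)" for s
    using that S inv_mem_rcoset_inv[OF g] rcoset_inv_eq_self_iff[OF g] sq
    by (auto simp: connection_set_def)
  moreover have "inv (inv s) = s" if "s \<in> S \<inter> (H #> g)" for s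
    using that sub by auto
  ultimately obtain s where s: "s \<in> H #> g" "inv s = s"
    using odd_card_involution_fixpoint[of "S \<inter> (H #> g)" "m_inv G"] odd by blast
  then obtain h where h: "h \<in> H" "s = g \<otimes> h"
    using coset_eq g by (auto simp: l_coset_def)
  have "s \<otimes> s = \<one>"
    using s sub by (metis r_inv subsetD)
  then show ?thesis
    using h g by (auto simp: numeral_2_eq_2)
qed

end

theorem theorem4p4:
  fixes G :: "('a, 'b) monoid_scheme" (structure) and H :: "'a set" and k :: nat
  assumes "group G" and "finite (carrier G)"
    and "H \<lhd> G" and "H \<noteq> {\<one>}" and "H \<noteq> carrier G"
    and "odd k" and "1 \<le> k" and "k \<le> card H"
  shows "group_zero_regular_set G k H \<longleftrightarrow>
    (\<forall>g \<in> carrier G. g [^] (2::nat) \<in> H \<longrightarrow> (\<exists>h \<in> H. (g \<otimes> h) [^] (2::nat) = \<one>))"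
proof -
  interpret normal H G
    by fact
  have iff: "group_zero_regular_set G k H \<longleftrightarrow>
    (\<exists>S. connection_set G S \<and> S \<inter> H = {} \<and> (\<forall>x\<in>carrier G - H. card (S \<inter> (H #> x)) = k))"
    unfolding group_zero_regular_set_def
    using zero_regular_set_Cay_iff[OF assms(2) _ assms(5)] by blast
  show ?thesis
  proof
    assume "group_zero_regular_set G k H"
    then obtain S where S: "connection_set G S" "\<forall>x\<in>carrier G - H. card (S \<inter> (H #> x)) = k"
      using iff by blast
    show "\<forall>g\<in>carrier G. g [^] (2::nat) \<in> H \<longrightarrow> (\<exists>h\<in>H. (g \<otimes> h) [^] (2::nat) = \<one>)"
    proof (intro ballI impI)
      fix g assume g: "g \<in> carrier G" "g [^] (2::nat) \<in> H"
      show "\<exists>h\<in>H. (g \<otimes> h) [^] (2::nat) = \<one>"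
      proof (cases "g \<in> H")
        case True
        \<comment> \<open>Regularity gives no odd count on the coset \<open>H\<close> itself, but
          here \<open>h = inv g\<close> makes the product trivial.\<close>
        then show ?thesis
          using g by (intro bexI[of _ "inv g"]) auto
      next
        case False
        then show ?thesis
          using ex_involution_in_rcoset[OF assms(2) S(1) g] S(2) g assms(6) by simp
      qed
    qed
  next
    assume "\<forall>g\<in>carrier G. g [^] (2::nat) \<in> H \<longrightarrow> (\<exists>h\<in>H. (g \<otimes> h) [^] (2::nat) = \<one>)"
    then show "group_zero_regular_set G k H"
      using iff ex_connection_set_meeting_rcosets[OF assms(2,6,8)] by blast
  qed
qed

end
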